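(* Let $n\ge1$ and $x,y\in\mathfrak{S}_n$. If $x$ covers $y$ in the left weak order on $\mathfrak{S}_n$, then $x\unrhd_R y$ and $\ell(x)=\ell(y)+1$.
   Context: Notation: $[m,n]=\{m,\dots,n\}$, $[n]=[1,n]$. For $a,b\in\mathbb{Z}^n$, $a\leq_C b$ means $a(i)\leq b(i)$ for all $i$. For $x\in[n]^n$ the conjugate is $x^*=(n+1-x(n),\dots,n+1-x(1))$. $\mathfrak{S}_n$ is the group of permutations of $[n]$, with products composed right to left; $s_i$ is the transposition of $i$ and $i+1$; $\ell(x)$ is the number of pairs $i<j$ with $x(i)>x(j)$. Left weak order on $\mathfrak{S}_n$: the partial order generated by (reflexive-transitive closure of) the relations $x>s_ix$ whenever $1\le i\le n-1$ and $\ell(x)>\ell(s_ix)$. Parking functions: cars $1,\dots,n$ enter, in this order, a one-way street with spots $1,\dots,n$. Given $a\in[n]^n$, car $i$ parks in the first (lowest-numbered) available spot in $[a(i),n]$; if there is none, the procedure fails. If all cars park, $a$ is a parking function, and its outcome is the permutation $\mathcal{O}(a)=w\in\mathfrak{S}_n$, where car $i$ parks in spot $w(i)$. Interval parking functions (IPFs): given $a,b\in[n]^n$ with $a\leq_C b$, car $i$ parks in the first available spot in $[a(i),b(i)]$; if there is none, the procedure fails. If all cars park, $(a,b)$ is an interval parking function. If $(a,b)$ is an IPF, then both $a$ and $b^*$ are parking functions. Reachability: $x\unrhd_R y$ means there exists an IPF $(a,b)$ with $x=\mathcal{O}(a)$ and $y=\mathcal{O}(b^* )^*$. *)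

theory Defs
  imports "HOL-Combinatorics.Permutations" "HOL-Library.FuncSet"
begin

text \<open>
  Permutations of \<open>[n]\<close> are functions \<open>x\<close> with \<open>x permutes {1..n}\<close>; in particular they are the
  identity outside \<open>[n]\<close>, and the product (right to left) is \<open>(\<circ>)\<close>. Elements of \<open>[n]\<^sup>n\<close> are
  members of \<open>words n\<close>; their values outside \<open>[n]\<close> are irrelevant.
\<close>

definition words :: "nat \<Rightarrow> (nat \<Rightarrow> nat) set" where
  "words n = {1..n} \<rightarrow> {1..n}"

text \<open>Set to be the identity outside \<open>[n]\<close>, so that the conjugate of a permutation of \<open>[n]\<close>
  is again one in the sense of \<open>permutes\<close>.\<close>

definition conjugate :: "nat \<Rightarrow> (nat \<Rightarrow> nat) \<Rightarrow> (nat \<Rightarrow> nat)" where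
  "conjugate n x = (\<lambda>i. if i \<in> {1..n} then n + 1 - x (n + 1 - i) else i)"

definition perm_length :: "nat \<Rightarrow> (nat \<Rightarrow> nat) \<Rightarrow> nat" where
  "perm_length n x = card {(i, j). i \<in> {1..n} \<and> j \<in> {1..n} \<and> i < j \<and> x i > x j}"

definition weak_step :: "nat \<Rightarrow> (nat \<Rightarrow> nat) \<Rightarrow> (nat \<Rightarrow> nat) \<Rightarrow> bool" where
  "weak_step n x y \<longleftrightarrow> x permutes {1..n} \<and>
     (\<exists>i. 1 \<le> i \<and> i < n \<and> y = transpose i (i + 1) \<circ> x \<and> perm_length n x > perm_length n y)"

text \<open>\<open>left_weak_ge n x y\<close> means that \<open>x\<close> is above \<open>y\<close>.\<close>

definition left_weak_ge :: "nat \<Rightarrow> (nat \<Rightarrow> nat) \<Rightarrow> (nat \<Rightarrow> nat) \<Rightarrow> bool" where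
  "left_weak_ge n = (weak_step n)\<^sup>*\<^sup>*"

definition left_weak_gt :: "nat \<Rightarrow> (nat \<Rightarrow> nat) \<Rightarrow> (nat \<Rightarrow> nat) \<Rightarrow> bool" where
  "left_weak_gt n x y \<longleftrightarrow> left_weak_ge n x y \<and> x \<noteq> y"

definition left_weak_covers :: "nat \<Rightarrow> (nat \<Rightarrow> nat) \<Rightarrow> (nat \<Rightarrow> nat) \<Rightarrow> bool" where
  "left_weak_covers n x y \<longleftrightarrow> left_weak_gt n x y \<and>
     \<not> (\<exists>z. z permutes {1..n} \<and> left_weak_gt n x z \<and> left_weak_gt n z y)"

text \<open>\<open>park a b k\<close> runs the procedure for cars \<open>1, \<dots>, k\<close>, where car \<open>i\<close> accepts the spots
  in \<open>[a(i), b(i)]\<close>. The result is \<open>None\<close> if some car fails to park; otherwise it is \<open>Some w\<close>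
  where \<open>w i\<close> is the spot of car \<open>i\<close> for \<open>i \<in> [k]\<close>, and \<open>w i = i\<close> elsewhere.\<close>

primrec park :: "(nat \<Rightarrow> nat) \<Rightarrow> (nat \<Rightarrow> nat) \<Rightarrow> nat \<Rightarrow> (nat \<Rightarrow> nat) option" where
  "park a b 0 = Some id"
| "park a b (Suc k) =
     (case park a b k of
        None \<Rightarrow> None
      | Some w \<Rightarrow>
          (let free = {a (Suc k)..b (Suc k)} - w ` {1..k}
           in if free = {} then None else Some (w(Suc k := Min free))))"

text \<open>A word \<open>a\<close> is a parking function iff its outcome is not \<open>None\<close>.\<close>

definition outcome :: "nat \<Rightarrow> (nat \<Rightarrow> nat) \<Rightarrow> (nat \<Rightarrow> nat) option" where
  "outcome n a = park a (\<lambda>_. n) n"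

definition interval_parking_function :: "nat \<Rightarrow> (nat \<Rightarrow> nat) \<Rightarrow> (nat \<Rightarrow> nat) \<Rightarrow> bool" where
  "interval_parking_function n a b \<longleftrightarrow>
     a \<in> words n \<and> b \<in> words n \<and> (\<forall>i\<in>{1..n}. a i \<le> b i) \<and> park a b n \<noteq> None"

definition reachable :: "nat \<Rightarrow> (nat \<Rightarrow> nat) \<Rightarrow> (nat \<Rightarrow> nat) \<Rightarrow> bool" where
  "reachable n x y \<longleftrightarrow>
     (\<exists>a b. interval_parking_function n a b \<and> outcome n a = Some x \<and>
        map_option (conjugate n) (outcome n (conjugate n b)) = Some y)"

end

theory Submission
  imports Defs
begin

text \<open>
  A cover in the left weak order is a single step \<open>y = s\<^sub>i x\<close> with \<open>\<ell>(x) > \<ell>(y)\<close>, since the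
  first step of a longer chain would lie strictly between \<open>x\<close> and \<open>y\<close>. Swapping the values \<open>i\<close>
  and \<open>i + 1\<close> affects only the inversion status of the two positions where they occur
  (\<open>perm_length_transpose\<close>). So the lengths differ by exactly one, and the car \<open>q\<close> parked by \<open>x\<close>
  in spot \<open>i + 1\<close> precedes the car \<open>p\<close> parked in spot \<open>i\<close>.

  For reachability, take \<open>a = x\<close> and let \<open>b\<close> agree with \<open>x\<close>, except that \<open>b(p) = i + 1\<close>. Every car
  finds its preferred spot \<open>x(j)\<close> free and within its interval, so \<open>(a, b)\<close> is an interval parking
  function and \<open>\<O>(a) = x\<close>. Parking \<open>b\<^sup>*\<close> amounts to letting the cars enter in the order
  \<open>n, \<dots>, 1\<close> from the other end of the street, car \<open>j\<close> taking the last free spot that is at most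
  \<open>b(j)\<close>. The cars \<open>p\<close> and \<open>q\<close> now both prefer spot \<open>i + 1\<close>; \<open>p\<close> arrives first and gets it, and
  \<open>q\<close> has to move on to the spot \<open>i\<close>, which no other car wants. All other cars park as in \<open>x\<close>,
  so the result is \<open>s\<^sub>i x = y\<close>.

  Both parking processes are evaluated with \<open>park_eqI\<close>: a permutation is the outcome as soon as
  each car's spot lies in its interval and all earlier spots of the interval were taken by
  previous cars.
\<close>

section \<open>Evaluating the parking process\<close>

lemma park_eqI:
  assumes z: "z permutes {1..n}"
    and le: "\<And>j. j \<in> {1..n} \<Longrightarrow> a j \<le> z j \<and> z j \<le> b j"
    and taken: "\<And>j s. j \<in> {1..n} \<Longrightarrow> a j \<le> s \<Longrightarrow> s < z j \<Longrightarrow> s \<in> z ` {1..<j}"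
  shows "park a b n = Some z"
proof -
  have inj: "inj z"
    using z by (rule permutes_inj)
  have "park a b k = Some (\<lambda>j. if j \<le> k then z j else j)" if "k \<le> n" for k
    using that
  proof (induction k)
    case 0
    have "z 0 = 0"
      using z by (auto simp: permutes_def)
    then show ?case
      by (auto simp: id_def)
  next
    case (Suc k)
    let ?w = "\<lambda>j. if j \<le> k then z j else j"
    let ?free = "{a (Suc k)..b (Suc k)} - ?w ` {1..k}"
    have IH: "park a b k = Some ?w"
      using Suc by simp
    have im: "?w ` {1..k} = z ` {1..<Suc k}"
      by (auto simp: image_iff)
    have mem: "z (Suc k) \<in> ?free"
      using le[of "Suc k"] Suc.prems unfolding im by (simp add: inj_image_mem_iff[OF inj])
    have "Min ?free = z (Suc k)"
    proof (rule Min_eqI)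
      show "z (Suc k) \<le> s" if s: "s \<in> ?free" for s
      proof (rule ccontr)
        assume "\<not> z (Suc k) \<le> s"
        then have "s \<in> z ` {1..<Suc k}"
          using s Suc.prems by (intro taken) auto
        then show False
          using s unfolding im by blast
      qed
    qed (use mem in auto)
    moreover have "?free \<noteq> {}"
      using mem by blast
    ultimately have "park a b (Suc k) = Some (?w(Suc k := z (Suc k)))"
      by (simp only: park.simps IH option.case Let_def if_False)
    also have "?w(Suc k := z (Suc k)) = (\<lambda>j. if j \<le> Suc k then z j else j)"
      by (auto simp: fun_eq_iff le_Suc_eq)
    finally show ?case .
  qed
  then have "park a b n = Some (\<lambda>j. if j \<le> n then z j else j)"
    by simp
  also have "(\<lambda>j. if j \<le> n then z j else j) = z"
    using z by (auto simp: fun_eq_iff permutes_def)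
  finally show ?thesis .
qed

section \<open>Conjugation\<close>

lemma conjugate_permutes:
  assumes "y permutes {1..n}"
  shows "conjugate n y permutes {1..n}"
proof (rule bij_imp_permutes)
  have mem: "y k \<in> {1..n}" if "k \<in> {1..n}" for k
    using permutes_in_image[OF assms] that by blast
  have inj: "inj_on (conjugate n y) {1..n}"
  proof (rule inj_onI)
    fix j k
    assume jk: "j \<in> {1..n}" "k \<in> {1..n}" "conjugate n y j = conjugate n y k"
    then have "y (n + 1 - j) = y (n + 1 - k)"
      using mem[of "n + 1 - j"] mem[of "n + 1 - k"] by (simp add: conjugate_def) linarith
    then have "n + 1 - j = n + 1 - k"
      using permutes_inj[OF assms] by (rule injD[rotated])
    then show "j = k"
      using jk by auto
  qed
  have "conjugate n y ` {1..n} \<subseteq> {1..n}"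
  proof (rule image_subsetI)
    fix j
    assume "j \<in> {1..n}"
    then show "conjugate n y j \<in> {1..n}"
      using mem[of "n + 1 - j"] by (simp add: conjugate_def) linarith
  qed
  then show "bij_betw (conjugate n y) {1..n} {1..n}"
    using inj by (simp add: bij_betw_def endo_inj_surj)
qed (auto simp: conjugate_def)

lemma conjugate_conjugate:
  assumes "y permutes {1..n}"
  shows "conjugate n (conjugate n y) = y"
proof
  fix j
  show "conjugate n (conjugate n y) j = y j"
  proof (cases "j \<in> {1..n}")
    case True
    then have "y j \<in> {1..n}"
      using permutes_in_image[OF assms] by blast
    with True show ?thesis
      by (auto simp: conjugate_def)
  next
    case False
    then show ?thesis
      using assms by (auto simp: conjugate_def permutes_def)
  qed
qed

section \<open>Adjacent transpositions and covers\<close>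

text \<open>No value lies between \<open>i\<close> and \<open>i + 1\<close>, so each of them compares in the same way with any
  third value; hence only the pair of positions \<open>(p, q)\<close> changes its inversion status.\<close>

lemma perm_length_transpose:
  assumes x: "x permutes {1..n}" and pq: "p < q" "p \<in> {1..n}" "q \<in> {1..n}"
    and xp: "x p = i" and xq: "x q = i + 1"
  shows "perm_length n (transpose i (i + 1) \<circ> x) = perm_length n x + 1"
proof -
  let ?y = "transpose i (i + 1) \<circ> x"
  let ?inv = "\<lambda>x. {(j, k). j \<in> {1..n} \<and> k \<in> {1..n} \<and> j < k \<and> x j > (x k :: nat)}"
  have p: "x j = i \<longleftrightarrow> j = p" for j
    using permutes_inj[OF x] xp by (auto dest: injD)
  have q: "x j = i + 1 \<longleftrightarrow> j = q" for j
    using permutes_inj[OF x] xq by (metis injD)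
  have y: "?y j = (if j = p then i + 1 else if j = q then i else x j)" for j
    using p[of j] q[of j] by (auto simp: transpose_def)
  have "?y j > ?y k \<longleftrightarrow> x j > x k \<or> (j = p \<and> k = q)" if "j < k" for j k
    unfolding y using that pq p[of j] p[of k] q[of j] q[of k] xp xq
    by (simp split: if_splits) linarith+
  then have "?inv ?y = insert (p, q) (?inv x)"
    using pq by blast
  moreover have "(p, q) \<notin> ?inv x"
    using xp xq by simp
  moreover have "finite (?inv x)"
    by (rule finite_subset[of _ "{1..n} \<times> {1..n}"]) auto
  ultimately show ?thesis
    by (simp add: perm_length_def)
qed

lemma weak_step_permutes:
  assumes "weak_step n x z"
  shows "z permutes {1..n}"
  using assms unfolding weak_step_def
  by (auto intro!: permutes_compose permutes_swap_id)

lemma left_weak_covers_imp_weak_step: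
  assumes "left_weak_covers n x y"
  shows "weak_step n x y"
proof -
  have ge: "(weak_step n)\<^sup>*\<^sup>* x y" and ne: "x \<noteq> y"
    and cov: "\<And>z. z permutes {1..n} \<Longrightarrow> left_weak_gt n x z \<Longrightarrow> \<not> left_weak_gt n z y"
    using assms by (auto simp: left_weak_covers_def left_weak_gt_def left_weak_ge_def)
  from ge ne obtain z where z: "weak_step n x z" "(weak_step n)\<^sup>*\<^sup>* z y"
    by (metis converse_rtranclpE)
  have "x \<noteq> z"
    using z(1) by (auto simp: weak_step_def)
  then have "left_weak_gt n x z"
    using z(1) by (auto simp: left_weak_gt_def left_weak_ge_def)
  then have "\<not> left_weak_gt n z y"
    using cov weak_step_permutes[OF z(1)] by blast
  then have "z = y"
    using z(2) by (auto simp: left_weak_gt_def left_weak_ge_def)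
  then show ?thesis
    using z(1) by simp
qed

section \<open>Reachability\<close>

lemma reachable_transpose:
  assumes x: "x permutes {1..n}" and y: "y permutes {1..n}"
    and y_def: "y = transpose i (i + 1) \<circ> x"
    and pq: "q < p" "p \<in> {1..n}" "q \<in> {1..n}"
    and xp: "x p = i" and xq: "x q = i + 1"
  shows "reachable n x y"
proof -
  define b where "b = x(p := i + 1)"
  have mem: "x j \<in> {1..n}" if "j \<in> {1..n}" for j
    using permutes_in_image[OF x] that by blast
  have y_mem: "y j \<in> {1..n}" if "j \<in> {1..n}" for j
    using permutes_in_image[OF y] that by blast
  have "i + 1 \<le> n"
    using mem[OF pq(3)] xq by auto
  then have words: "x \<in> words n" "b \<in> words n"
    using mem by (auto simp: words_def b_def)
  have le: "x j \<le> b j" for j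
    using xp by (auto simp: b_def)
  have park: "park x b n = Some x"
    by (rule park_eqI[OF x]) (use le in auto)
  have out_x: "outcome n x = Some x"
    unfolding outcome_def by (rule park_eqI[OF x]) (use mem in auto)
  let ?z = "conjugate n y" and ?c = "conjugate n b"
  have x_inj: "x j = i \<longleftrightarrow> j = p" "x j = i + 1 \<longleftrightarrow> j = q" for j
    using permutes_inj[OF x] xp xq by (metis injD)+
  \<comment> \<open>Since \<open>q\<close> loses spot \<open>i + 1\<close> to \<open>p\<close>, the words \<open>b\<close> and \<open>y\<close> differ only at \<open>q\<close>.\<close>
  have yq: "y q = i" and yp: "y p = i + 1" and bq: "b q = i + 1"
    using xp xq pq by (auto simp: y_def b_def)
  have b_eq: "b j = y j" if "j \<noteq> q" for j
    using that x_inj[of j] xp by (auto simp: b_def y_def transpose_def)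
  have "outcome n ?c = Some ?z"
    unfolding outcome_def
  proof (rule park_eqI[OF conjugate_permutes[OF y]])
    fix j
    assume j: "j \<in> {1..n}"
    then have j': "n + 1 - j \<in> {1..n}"
      by auto
    have c: "?c j = n + 1 - b (n + 1 - j)" and z: "?z j = n + 1 - y (n + 1 - j)"
      using j by (simp_all add: conjugate_def)
    show "?c j \<le> ?z j \<and> ?z j \<le> n"
    proof (cases "n + 1 - j = q")
      case True
      then show ?thesis
        using y_mem[OF j'] unfolding c z True bq yq by (simp, linarith)
    next
      case False
      then show ?thesis
        using y_mem[OF j'] unfolding c z b_eq[OF False] by (simp, linarith)
    qed
    fix s
    assume s: "?c j \<le> s" "s < ?z j"
    have jq: "n + 1 - j = q"
    proof (rule ccontr)
      assume ne: "n + 1 - j \<noteq> q"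
      from s show False
        unfolding c z b_eq[OF ne] by simp
    qed
    \<comment> \<open>The only spot passed over is the mirror image of \<open>i + 1\<close>, which the mirror image of
      \<open>p\<close> occupies.\<close>
    have "s = n - i"
      using s unfolding c z jq bq yq by simp
    moreover have "?z (n + 1 - p) = n - i"
      using pq yp by (simp add: conjugate_def) linarith
    moreover have "n + 1 - p \<in> {1..<j}"
      using pq j jq unfolding atLeastAtMost_iff atLeastLessThan_iff by linarith
    ultimately show "s \<in> ?z ` {1..<j}"
      by (intro image_eqI[of s ?z "n + 1 - p"]) simp_all
  qed
  then show ?thesis
    unfolding reachable_def interval_parking_function_def
    using words le park out_x conjugate_conjugate[OF y]
    by (intro exI[of _ x] exI[of _ b]) auto
qed

theorem proposition6p1:
  fixes n :: nat and x y :: "nat \<Rightarrow> nat"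
  assumes "n \<ge> 1"
    and "x permutes {1..n}" and "y permutes {1..n}"
    and "left_weak_covers n x y"
  shows "reachable n x y \<and> perm_length n x = perm_length n y + 1"
proof -
  obtain i where i: "1 \<le> i" "i < n" and y: "y = transpose i (i + 1) \<circ> x"
    and less: "perm_length n y < perm_length n x"
    using left_weak_covers_imp_weak_step[OF assms(4)] by (auto simp: weak_step_def)
  have surj: "x ` {1..n} = {1..n}"
    using assms(2) by (rule permutes_image)
  have "i \<in> x ` {1..n}" "i + 1 \<in> x ` {1..n}"
    using i unfolding surj by auto
  then obtain p q where p: "p \<in> {1..n}" "x p = i" and q: "q \<in> {1..n}" "x q = i + 1"
    by (metis imageE)
  \<comment> \<open>If \<open>p\<close> came before \<open>q\<close>, then the swap would increase the length.\<close>
  have "\<not> p < q"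
    using perm_length_transpose[OF assms(2) _ p(1) q(1) p(2) q(2)] less y by auto
  moreover have "p \<noteq> q"
    using p q by auto
  ultimately have qp: "q < p"
    by simp
  have "y q = i" "y p = i + 1" "x = transpose i (i + 1) \<circ> y"
    using p q by (auto simp: y fun_eq_iff)
  then have "perm_length n x = perm_length n y + 1"
    using perm_length_transpose[OF assms(3) qp q(1) p(1)] by simp
  moreover have "reachable n x y"
    by (rule reachable_transpose[OF assms(2,3) y qp p(1) q(1) p(2) q(2)])
  ultimately show ?thesis
    by blast
qed

end
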